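(* Let $\Theta=(\Gamma,(x_{k,i}))$ be a patch framework in $\mathbb{R}^d$ with $\Gamma$ connected and with every view affinely non-degenerate. A perfect alignment $S$ is non-degenerate if $|\mathbb{G}^*(S)|=1$.
   Context: Patch framework. $\Gamma$ is a bipartite graph on $n+m$ vertices; vertex $k\in\{1,\dots,n\}$ represents the $k$th point and vertex $n+i$, $i\in\{1,\dots,m\}$, the $i$th view; $(k,i)\in E(\Gamma)$ means that point $k$ is in view $i$, with local coordinates $x_{k,i}\in\mathbb{R}^d$. The tuple $\Theta=(\Gamma,(x_{k,i}))$ is a patch framework. A view $i$ is affinely non-degenerate if it has at least $d+1$ points and the affine span of $\{x_{k,i}:(k,i)\in E(\Gamma)\}$ has dimension $d$. Put $e_{ki}=e_k-e_{n+i}\in\mathbb{R}^{n+m}$, $\varepsilon_i$ the $i$th standard basis vector of $\mathbb{R}^m$, $\mathcal{L}_\Gamma=\sum_{(k,i)\in E(\Gamma)}e_{ki}e_{ki}^T$, $B=\sum_{(k,i)\in E(\Gamma)}(\varepsilon_i\otimes I_d)x_{k,i}e_{ki}^T$, $D=\sum_{(k,i)\in E(\Gamma)}(\varepsilon_i\otimes I_d)x_{k,i}x_{k,i}^T(\varepsilon_i\otimes I_d)^T$, and $C=D-B\mathcal{L}_\Gamma^\dagger B^T\in\mathbb{R}^{md\times md}$ (positive semi-definite), where $\dagger$ is the Moore–Penrose pseudoinverse. An alignment is an element $S=[S_i]_1^m$ (vertical stack) of $\mathbb{O}(d)^m\subseteq\mathbb{R}^{md\times d}$; $F(S)=\mathrm{Tr}(CSS^T)$;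 $S$ is perfect if $F(S)=0$. Let $\pi:\mathbb{O}(d)^m\to\mathbb{O}(d)^{m-1}$, $\pi(S)=[S_{i+1}S_1^T]_{i=1}^{m-1}$ (identifying $\mathbb{O}(d)^m/_\sim$, $S\sim SQ$ for $Q\in\mathbb{O}(d)$, with $\mathbb{O}(d)^{m-1}$), and $\widetilde F:\mathbb{O}(d)^{m-1}\to\mathbb{R}$, $\widetilde F(\widetilde S)=\mathrm{Tr}\left(C\begin{bmatrix}I_d\\ \widetilde S\end{bmatrix}\begin{bmatrix}I_d\\ \widetilde S\end{bmatrix}^T\right)$. $S$ is non-degenerate if $\pi(S)$ is a local minimizer of $\widetilde F$ at which the Hessian is non-singular (at a critical point this does not depend on the Riemannian metric). The graph $\mathbb{G}$. For a collection of views, two views $i\neq j$ are joined by an edge of $\mathbb{G}$ iff $\mathrm{rank}(\overline B_{i,j})\ge d-1$, where $B_{i,j}$ has as columns the local coordinates in view $i$ of the points common to views $i$ and $j$, $n'$ is the number of these points, and $\overline B_{i,j}=B_{i,j}(I_{n'}-(1/n')\mathbf{1}_{n'}\mathbf{1}_{n'}^T)$ ($\mathbf{1}_{n'}$ the all-ones vector). For perfectly alignable views this condition is symmetric in $i,j$. Coarsening. Given a perfect alignment $S$, let $H=S^TB\mathcal{L}_\Gamma^\dagger(I_{n+m}-n^{-1}\mathbf{1}^{n+m}_n\mathbf{1}_{n+m}^T)$, where $\mathbf{1}^{n+m}_n$ has first $n$ entries $1$ and the rest $0$, and let $t_i$ be column $n+i$ of $H$. (i) Transform all views using $S$ and $t$: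 replace $x_{k,i}$ by $S_i^Tx_{k,i}+t_i$ (since $S$ is perfect, the coordinates of a point then agree in all views containing it). (ii) Merge the views that lie in the same connected component of $\mathbb{G}$, replacing them by a single view (containing the union of their points, with these common coordinates). (iii) Construct, in the same manner as $\mathbb{G}$, the graph associated with the new set of views. (iv) Repeat from (ii) until no further merging occurs. $\mathbb{G}^*(S)$ is the final graph over the remaining views, and $|\mathbb{G}^*(S)|$ is its number of vertices. *)

theory Defs
  imports "HOL-Analysis.Analysis" "HOL-Library.While_Combinator"
begin

text \<open>
  Points are indexed by \<open>'n\<close>, views by \<open>'m\<close>, coordinates by \<open>'d\<close>.  Vertices of \<open>\<Gamma>\<close> are the
  elements of \<open>'n + 'm\<close>; as \<open>\<Gamma>\<close> is bipartite it is given by \<open>E :: ('n \<times> 'm) set\<close>.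
  Every definition uses \<open>x k i\<close> only for \<open>(k, i) \<in> E\<close>.
  The \<open>md\<close> block indices are \<open>'m \<times> 'd\<close>, and \<open>u v\<^sup>T\<close> is \<open>outer u v\<close>.
\<close>

subsection \<open>Patch frameworks\<close>

definition patch_edges :: "('n \<times> 'm) set \<Rightarrow> (('n + 'm) \<times> ('n + 'm)) set" where
  "patch_edges E = (\<Union>(k, i)\<in>E. {(Inl k, Inr i), (Inr i, Inl k)})"

definition patch_connected :: "('n \<times> 'm) set \<Rightarrow> bool" where
  "patch_connected E \<longleftrightarrow> (\<forall>u v. (u, v) \<in> (patch_edges E)\<^sup>*)"

definition view_points :: "('n \<times> 'm) set \<Rightarrow> 'm \<Rightarrow> 'n set" where
  "view_points E i = {k. (k, i) \<in> E}"

definition affinely_nondegenerate ::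
  "('n::finite \<times> 'm) set \<Rightarrow> ('n \<Rightarrow> 'm \<Rightarrow> real^'d) \<Rightarrow> 'm \<Rightarrow> bool" where
  "affinely_nondegenerate E x i \<longleftrightarrow>
     card (view_points E i) \<ge> CARD('d) + 1 \<and>
     aff_dim (affine hull ((\<lambda>k. x k i) ` view_points E i)) = int CARD('d)"

subsection \<open>The matrix \<open>C\<close>\<close>

text \<open>The unique matrix satisfying the four Penrose equations.\<close>
definition pinv :: "real^'c^'r \<Rightarrow> real^'r^'c" where
  "pinv A = (THE X. A ** X ** A = A \<and> X ** A ** X = X \<and>
                    transpose (A ** X) = A ** X \<and> transpose (X ** A) = X ** A)"

definition outer :: "real^'r \<Rightarrow> real^'c \<Rightarrow> real^'c^'r" where
  "outer u v = (\<chi> a b. u $ a * v $ b)"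

definition edge_vec :: "'n::finite \<Rightarrow> 'm::finite \<Rightarrow> real^('n + 'm)" where
  "edge_vec k i = axis (Inl k) 1 - axis (Inr i) 1"

text \<open>Kronecker product \<open>u \<otimes> A\<close> of a column vector and a matrix.\<close>
definition vec_kron :: "real^'m \<Rightarrow> real^'c^'r \<Rightarrow> real^'c^('m \<times> 'r)" where
  "vec_kron u A = (\<chi> p b. u $ fst p * A $ snd p $ b)"

definition patch_L :: "('n::finite \<times> 'm::finite) set \<Rightarrow> real^('n + 'm)^('n + 'm)" where
  "patch_L E = (\<Sum>(k, i)\<in>E. outer (edge_vec k i) (edge_vec k i))"

definition patch_B ::
  "('n::finite \<times> 'm::finite) set \<Rightarrow> ('n \<Rightarrow> 'm \<Rightarrow> real^'d) \<Rightarrow> real^('n + 'm)^('m \<times> 'd)" where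
  "patch_B E x = (\<Sum>(k, i)\<in>E.
     vec_kron (axis i 1) (mat 1) ** outer (x k i) (edge_vec k i))"

definition patch_D ::
  "('n::finite \<times> 'm::finite) set \<Rightarrow> ('n \<Rightarrow> 'm \<Rightarrow> real^'d) \<Rightarrow> real^('m \<times> 'd)^('m \<times> 'd)" where
  "patch_D E x = (\<Sum>(k, i)\<in>E.
     vec_kron (axis i 1) (mat 1) ** outer (x k i) (x k i)
       ** transpose (vec_kron (axis i 1) (mat 1)))"

definition patch_C ::
  "('n::finite \<times> 'm::finite) set \<Rightarrow> ('n \<Rightarrow> 'm \<Rightarrow> real^'d) \<Rightarrow> real^('m \<times> 'd)^('m \<times> 'd)" where
  "patch_C E x = patch_D E x - patch_B E x ** pinv (patch_L E) ** transpose (patch_B E x)"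

subsection \<open>Alignments\<close>

definition block :: "real^'d^('m::finite \<times> 'd) \<Rightarrow> 'm \<Rightarrow> real^'d^'d" where
  "block S i = (\<chi> a. S $ (i, a))"

definition alignments :: "(real^'d^('m::finite \<times> 'd)) set" where
  "alignments = {S. \<forall>i. orthogonal_matrix (block S i)}"

definition align_F ::
  "('n::finite \<times> 'm::finite) set \<Rightarrow> ('n \<Rightarrow> 'm \<Rightarrow> real^'d) \<Rightarrow> real^'d^('m \<times> 'd) \<Rightarrow> real" where
  "align_F E x S = trace (patch_C E x ** S ** transpose S)"

definition perfect ::
  "('n::finite \<times> 'm::finite) set \<Rightarrow> ('n \<Rightarrow> 'm \<Rightarrow> real^'d) \<Rightarrow> real^'d^('m \<times> 'd) \<Rightarrow> bool" where
  "perfect E x S \<longleftrightarrow> S \<in> alignments \<and> align_F E x S = 0"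

subsection \<open>Non-degeneracy\<close>

definition first_view :: "'m::{finite,linorder}" where
  "first_view = Min UNIV"

text \<open>
  There is no index type with \<open>m - 1\<close> elements when \<open>m = 1\<close>, so an \<open>(m-1)d \<times> d\<close> stack is an
  \<open>md \<times> d\<close> stack whose block at the first view is zero; this is a linear isometry onto its image.
\<close>
definition reduced_alignments :: "(real^'d^('m::{finite,linorder} \<times> 'd)) set" where
  "reduced_alignments =
     {Z. block Z first_view = 0 \<and> (\<forall>i. i \<noteq> first_view \<longrightarrow> orthogonal_matrix (block Z i))}"

definition reduce :: "real^'d^('m::{finite,linorder} \<times> 'd) \<Rightarrow> real^'d^('m \<times> 'd)" where
  "reduce S = (\<chi> p. if fst p = first_view then 0
                    else (block S (fst p) ** transpose (block S first_view)) $ snd p)"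

text \<open>The stack of \<open>I\<^sub>d\<close> on top of \<open>Z\<close>.\<close>
definition stack_id :: "real^'d^('m::{finite,linorder} \<times> 'd) \<Rightarrow> real^'d^('m \<times> 'd)" where
  "stack_id Z = (\<chi> p. if fst p = first_view then mat 1 $ snd p else Z $ p)"

definition reduced_F ::
  "('n::finite \<times> 'm::{finite,linorder}) set \<Rightarrow> ('n \<Rightarrow> 'm \<Rightarrow> real^'d) \<Rightarrow>
   real^'d^('m \<times> 'd) \<Rightarrow> real" where
  "reduced_F E x Z = trace (patch_C E x ** stack_id Z ** transpose (stack_id Z))"

definition local_minimizer_on :: "'a::topological_space set \<Rightarrow> ('a \<Rightarrow> real) \<Rightarrow> 'a \<Rightarrow> bool" where
  "local_minimizer_on M f p \<longleftrightarrow> p \<in> M \<and> (\<forall>\<^sub>F q in at p within M. f p \<le> f q)"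

definition C2_curve_in ::
  "'a::real_normed_vector set \<Rightarrow> 'a \<Rightarrow> 'a \<Rightarrow> (real \<Rightarrow> 'a) \<Rightarrow> bool" where
  "C2_curve_in M p v c \<longleftrightarrow> c 0 = p \<and>
     (\<exists>e>0. \<exists>c' c''. c' 0 = v \<and> continuous_on {-e<..<e} c'' \<and>
        (\<forall>t\<in>{-e<..<e}. c t \<in> M \<and> (c has_vector_derivative c' t) (at t) \<and>
                        (c' has_vector_derivative c'' t) (at t)))"

definition tangent_space :: "'a::real_normed_vector set \<Rightarrow> 'a \<Rightarrow> 'a set" where
  "tangent_space M p = {v. \<exists>c. C2_curve_in M p v c}"

text \<open>
  The Hessian of \<open>f\<close> on an embedded submanifold \<open>M\<close> at a critical point \<open>p\<close> is the symmetric
  bilinear form on the tangent space whose value at \<open>(v, v)\<close> is \<open>(f \<circ> c)''(0)\<close> for every curve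
  \<open>c\<close> in \<open>M\<close> with \<open>c(0) = p\<close>, \<open>c'(0) = v\<close>.  Criticality is what makes this independent of
  \<open>c''(0)\<close>, hence of a metric; by polarization \<open>H\<close> is determined on the tangent space, and its
  values outside the tangent space are irrelevant.
\<close>
definition is_hessian_at ::
  "'a::real_normed_vector set \<Rightarrow> ('a \<Rightarrow> real) \<Rightarrow> 'a \<Rightarrow> ('a \<Rightarrow> 'a \<Rightarrow> real) \<Rightarrow> bool" where
  "is_hessian_at M f p H \<longleftrightarrow> bilinear H \<and> (\<forall>v w. H v w = H w v) \<and>
     (\<forall>v c. C2_curve_in M p v c \<longrightarrow>
        (\<exists>g. (\<forall>\<^sub>F t in nhds 0. ((\<lambda>s. f (c s)) has_real_derivative g t) (at t)) \<and>
             (g has_real_derivative H v v) (at 0)))"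

definition hessian_nonsingular_at ::
  "'a::real_normed_vector set \<Rightarrow> ('a \<Rightarrow> real) \<Rightarrow> 'a \<Rightarrow> bool" where
  "hessian_nonsingular_at M f p \<longleftrightarrow> (\<exists>H. is_hessian_at M f p H \<and>
     (\<forall>v\<in>tangent_space M p. (\<forall>w\<in>tangent_space M p. H v w = 0) \<longrightarrow> v = 0))"

definition nondegenerate ::
  "('n::finite \<times> 'm::{finite,linorder}) set \<Rightarrow> ('n \<Rightarrow> 'm \<Rightarrow> real^'d) \<Rightarrow>
   real^'d^('m \<times> 'd) \<Rightarrow> bool" where
  "nondegenerate E x S \<longleftrightarrow>
     local_minimizer_on reduced_alignments (reduced_F E x) (reduce S) \<and>
     hessian_nonsingular_at reduced_alignments (reduced_F E x) (reduce S)"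

subsection \<open>The graph of a collection of views\<close>

text \<open>
  A collection of views is a set \<open>V\<close> with the points \<open>pts u\<close> of each view and their coordinates
  \<open>y k u\<close>.  Since the number \<open>n'\<close> of common points is not a type, the \<open>d \<times> n'\<close> matrix
  \<open>B\<^sub>u\<^sub>v\<close> and the vector \<open>1\<^sub>n\<^sub>'\<close> are padded with zeros at the other points;
  this only adds zero columns to the centred matrix and does not change its rank.
\<close>
definition common_B ::
  "('v \<Rightarrow> 'n::finite set) \<Rightarrow> ('n \<Rightarrow> 'v \<Rightarrow> real^'d) \<Rightarrow> 'v \<Rightarrow> 'v \<Rightarrow> real^'n^'d" where
  "common_B pts y u v = (\<chi> a k. if k \<in> pts u \<inter> pts v then y k u $ a else 0)"

definition ones_on :: "'a::finite set \<Rightarrow> real^'a" where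
  "ones_on K = (\<chi> k. if k \<in> K then 1 else 0)"

definition common_B_centred ::
  "('v \<Rightarrow> 'n::finite set) \<Rightarrow> ('n \<Rightarrow> 'v \<Rightarrow> real^'d) \<Rightarrow> 'v \<Rightarrow> 'v \<Rightarrow> real^'n^'d" where
  "common_B_centred pts y u v = (let K = pts u \<inter> pts v in
     common_B pts y u v **
       (mat 1 - (1 / real (card K)) *\<^sub>R outer (ones_on K) (ones_on K)))"

definition view_graph ::
  "'v set \<Rightarrow> ('v \<Rightarrow> 'n::finite set) \<Rightarrow> ('n \<Rightarrow> 'v \<Rightarrow> real^'d) \<Rightarrow> ('v \<times> 'v) set" where
  "view_graph V pts y = {(u, v). u \<in> V \<and> v \<in> V \<and> u \<noteq> v \<and>
     rank (common_B_centred pts y u v) \<ge> CARD('d) - 1}"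

definition graph_components :: "'v set \<Rightarrow> ('v \<times> 'v) set \<Rightarrow> 'v set set" where
  "graph_components V R = V // ((R \<union> R\<inverse>)\<^sup>* \<inter> V \<times> V)"

subsection \<open>Coarsening\<close>

definition patch_H ::
  "('n::finite \<times> 'm::finite) set \<Rightarrow> ('n \<Rightarrow> 'm \<Rightarrow> real^'d) \<Rightarrow>
   real^'d^('m \<times> 'd) \<Rightarrow> real^('n + 'm)^'d" where
  "patch_H E x S = transpose S ** patch_B E x ** pinv (patch_L E) **
     (mat 1 - (1 / real CARD('n)) *\<^sub>R
        outer (ones_on (range Inl)) (ones_on UNIV))"

definition aligned_coord ::
  "('n::finite \<times> 'm::finite) set \<Rightarrow> ('n \<Rightarrow> 'm \<Rightarrow> real^'d) \<Rightarrow>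
   real^'d^('m \<times> 'd) \<Rightarrow> 'n \<Rightarrow> 'm \<Rightarrow> real^'d" where
  "aligned_coord E x S k i = transpose (block S i) *v x k i + column (Inr i) (patch_H E x S)"

text \<open>
  A merged view is represented by the set of original views it was merged from, so that the
  current collection of views is always a partition of the original ones.
\<close>
definition merged_points :: "('n \<times> 'm) set \<Rightarrow> 'm set \<Rightarrow> 'n set" where
  "merged_points E U = (\<Union>i\<in>U. view_points E i)"

text \<open>The common value of the aligned coordinates of \<open>k\<close>, for \<open>k \<in> merged_points E U\<close>.\<close>
definition merged_coord ::
  "('n::finite \<times> 'm::finite) set \<Rightarrow> ('n \<Rightarrow> 'm \<Rightarrow> real^'d) \<Rightarrow>
   real^'d^('m \<times> 'd) \<Rightarrow> 'n \<Rightarrow> 'm set \<Rightarrow> real^'d" where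
  "merged_coord E x S k U =
     (THE c. \<forall>i\<in>U. k \<in> view_points E i \<longrightarrow> aligned_coord E x S k i = c)"

definition merged_graph ::
  "('n::finite \<times> 'm::finite) set \<Rightarrow> ('n \<Rightarrow> 'm \<Rightarrow> real^'d) \<Rightarrow>
   real^'d^('m \<times> 'd) \<Rightarrow> 'm set set \<Rightarrow> ('m set \<times> 'm set) set" where
  "merged_graph E x S P = view_graph P (merged_points E) (merged_coord E x S)"

definition merge_views ::
  "('n::finite \<times> 'm::finite) set \<Rightarrow> ('n \<Rightarrow> 'm \<Rightarrow> real^'d) \<Rightarrow>
   real^'d^('m \<times> 'd) \<Rightarrow> 'm set set \<Rightarrow> 'm set set" where
  "merge_views E x S P = Union ` graph_components P (merged_graph E x S P)"

text \<open>The vertices of \<open>\<bbbG>\<^sup>*(S)\<close>.\<close>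
definition final_views ::
  "('n::finite \<times> 'm::finite) set \<Rightarrow> ('n \<Rightarrow> 'm \<Rightarrow> real^'d) \<Rightarrow>
   real^'d^('m \<times> 'd) \<Rightarrow> 'm set set" where
  "final_views E x S =
     while (\<lambda>P. merge_views E x S P \<noteq> P) (merge_views E x S) (range (\<lambda>i. {i}))"

end

theory Submission
  imports Defs
begin

text \<open>
  Since \<open>L\<^sup>\<dagger>\<close> is symmetric and \<open>L\<^sup>\<dagger> L L\<^sup>\<dagger> = L\<^sup>\<dagger>\<close>, the matrix \<open>C\<close> is the sum of the \<open>g g\<^sup>T\<close> over the
  edges \<open>(k, i)\<close>, where \<open>g = (\<epsilon>\<^sub>i \<otimes> I) x\<^sub>k\<^sub>i - B L\<^sup>\<dagger> e\<^sub>k\<^sub>i\<close>.  So the objective is a sum of squares that vanish at a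
  perfect alignment, and its Hessian there is the Gram form of the maps \<open>v \<mapsto> v\<^sup>T g\<close>.  A tangent vector \<open>v\<close>
  in its kernel is an infinitesimal motion of the aligned points that restricts on view \<open>i\<close> to a rigid
  motion with skew part \<open>A\<^sub>i\<close>.  If two views share points spanning a hyperplane, the difference of
  their skew parts has a kernel of codimension at most one, so it is zero; hence both views carry the same
  rigid motion, and this is inherited by merged views.  If everything merges, all \<open>A\<^sub>i\<close> agree with the
  one of the first view, which is zero.
\<close>

subsection \<open>Outer products and pseudoinverses\<close>

lemma outer_simps:
  fixes A :: "real^'r^'q" and B :: "real^'c^'q" and u :: "real^'r" and v :: "real^'c"
  shows matrix_mult_outer: "A ** outer u v = outer (A *v u) v"
    and outer_matrix_mult: "outer u v ** transpose B = outer u (B *v v)"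
    and transpose_outer: "transpose (outer u v) = outer v u"
    and outer_vector_mult: "outer u v *v w = (v \<bullet> w) *\<^sub>R u"
    and outer_zero: "outer 0 v = 0" "outer u 0 = 0"
  by (simp_all add: vec_eq_iff outer_def matrix_matrix_mult_def matrix_vector_mult_def
      transpose_def inner_vec_def sum_distrib_left sum_distrib_right mult.assoc)
     (auto simp: ac_simps)

lemma outer_diff:
  "outer (u - u') v = outer u v - outer u' v" "outer u (v - v') = outer u v - outer u v'"
  by (simp_all add: vec_eq_iff outer_def algebra_simps)

lemma trace_outer: "trace (outer u v) = u \<bullet> v"
  by (simp add: trace_def outer_def inner_vec_def)

lemma trace_sum: "trace (sum f A) = (\<Sum>a\<in>A. trace (f a))"
  for f :: "'a \<Rightarrow> real^'n^'n"
  unfolding trace_def by (simp add: sum.swap[of _ A])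

lemma matrix_mult_sum_right: "A ** (\<Sum>i\<in>I. f i) = (\<Sum>i\<in>I. A ** f i)"
  for A :: "real^'r^'q" and f :: "'i \<Rightarrow> real^'c^'r"
  by (simp add: vec_eq_iff matrix_matrix_mult_def sum_distrib_left sum.swap[of _ I])

lemma matrix_mult_sum_left: "(\<Sum>i\<in>I. f i) ** A = (\<Sum>i\<in>I. f i ** A)"
  for A :: "real^'r^'q" and f :: "'i \<Rightarrow> real^'q^'c"
  by (simp add: vec_eq_iff matrix_matrix_mult_def sum_distrib_right sum.swap[of _ I])

lemma transpose_sum: "transpose (\<Sum>i\<in>I. f i) = (\<Sum>i\<in>I. transpose (f i))"
  for f :: "'i \<Rightarrow> real^'r^'c"
  by (simp add: vec_eq_iff transpose_def)

lemma matrix_vector_mult_sum_left: "(\<Sum>i\<in>I. f i) *v v = (\<Sum>i\<in>I. f i *v v)"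
  for f :: "'i \<Rightarrow> real^'r^'c"
  by (simp add: vec_eq_iff matrix_vector_mult_def sum_distrib_right sum.swap[of _ I])

lemma matrix_diff_ldistrib: "A ** (B - C) = A ** B - A ** C"
  for A :: "real^'r^'q"
  by (simp add: vec_eq_iff matrix_matrix_mult_def right_diff_distrib sum_subtractf)

lemma matrix_add_rdistrib: "(B + C) ** A = B ** A + C ** A"
  for A :: "real^'r^'q"
  by (simp add: vec_eq_iff matrix_matrix_mult_def distrib_right sum.distrib)

lemma matrix_diff_rdistrib: "(B - C) ** A = B ** A - C ** A"
  for A :: "real^'r^'q"
  by (simp add: vec_eq_iff matrix_matrix_mult_def left_diff_distrib sum_subtractf)

lemma matrix_mult_minus: "A ** (- B) = - (A ** B)" "(- C) ** A = - (C ** A)"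
  for A :: "real^'r^'q"
  by (simp_all add: vec_eq_iff matrix_matrix_mult_def sum_negf)

lemma transpose_diff: "transpose (A - B) = transpose A - transpose B"
  for A :: "real^'r^'q"
  by (simp add: vec_eq_iff transpose_def)

lemma transpose_add: "transpose (A + B) = transpose A + transpose B"
  for A :: "real^'r^'q"
  by (simp add: vec_eq_iff transpose_def)

section \<open>Orthogonal projections and Moore-Penrose pseudoinverses\<close>

text \<open>An orthonormal basis of the kernel gives \<open>P\<close> as the sum of the
  \<open>outer b b\<close>; every claim then reduces to \<open>P\<close> fixing each
  \<open>b\<close>.\<close>

lemma kernel_projection:
  fixes A :: "real^'n^'q"
  obtains P :: "real^'n^'n" where "transpose P = P" "P ** P = P" "A ** P = 0"
    "\<And>v. A *v v = 0 \<Longrightarrow> P *v v = v"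
proof -
  let ?K = "{v. A *v v = 0}"
  have "subspace ?K"
    by (auto simp: subspace_def matrix_vector_right_distrib matrix_vector_mult_scaleR)
  then obtain B where B: "B \<subseteq> ?K" "pairwise orthogonal B" "\<And>x. x \<in> B \<Longrightarrow> norm x = 1"
      "independent B" "span B = ?K"
    by (metis orthonormal_basis_subspace)
  have fin: "finite B"
    using B(4) independent_imp_finite by blast
  define P where "P = (\<Sum>b\<in>B. outer b b)"
  have Pb: "P *v b = b" if "b \<in> B" for b
  proof -
    have "P *v b = (\<Sum>b'\<in>B. (b' \<bullet> b) *\<^sub>R b')"
      by (simp add: P_def matrix_vector_mult_sum_left outer_vector_mult)
    also have "\<dots> = (\<Sum>b'\<in>B. if b' = b then b else 0)"
      using B(2,3) that
      by (intro sum.cong refl) (auto simp: pairwise_def orthogonal_def dot_square_norm)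
    finally show ?thesis
      using fin that by simp
  qed
  have Pv: "P *v v = v" if "A *v v = 0" for v
  proof (rule linear_eq_on_span[where f = "(*v) P" and g = id and B = B, unfolded id_def])
    show "v \<in> span B"
      using that B(5) by simp
  qed (auto simp: Pb module_hom_ident linear_ident)
  show ?thesis
  proof (rule that)
    show "transpose P = P"
      by (simp add: P_def transpose_sum transpose_outer)
    show "P ** P = P"
      by (subst (2) P_def, subst (2) P_def) (simp add: matrix_mult_sum_right matrix_mult_outer Pb)
    show "A ** P = 0"
      using B(1) by (auto simp: P_def matrix_mult_sum_right matrix_mult_outer outer_zero intro!: sum.neutral)
  qed (fact Pv)
qed

text \<open>The predicate under the \<open>THE\<close> in \<open>pinv\<close>, named so that
  uniqueness and existence can be treated separately.\<close>

definition penrose :: "real^'c^'r \<Rightarrow> real^'r^'c \<Rightarrow> bool" where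
  "penrose A X \<longleftrightarrow> A ** X ** A = A \<and> X ** A ** X = X \<and>
     transpose (A ** X) = A ** X \<and> transpose (X ** A) = X ** A"

text \<open>Transposing \<open>(A ** Y) ** (A ** X)\<close>, a product of symmetric factors,
  reverses it, so \<open>A ** X\<close> and \<open>A ** Y\<close> coincide; the same holds for
  \<open>X ** A\<close> and \<open>Y ** A\<close>. Then \<open>X = X ** A ** X\<close> turns into
  \<open>Y ** A ** Y = Y\<close>.\<close>

lemma penrose_unique:
  assumes "penrose A X" "penrose A Y"
  shows "X = Y"
proof -
  have X: "A ** X ** A = A" "X ** A ** X = X" "transpose (A ** X) = A ** X" "transpose (X ** A) = X ** A"
    and Y: "A ** Y ** A = A" "Y ** A ** Y = Y" "transpose (A ** Y) = A ** Y" "transpose (Y ** A) = Y ** A"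
    using assms by (simp_all add: penrose_def)
  have "A ** X = (A ** Y) ** (A ** X)"
    using Y(1) by (metis matrix_mul_assoc)
  then have "A ** X = transpose ((A ** Y) ** (A ** X))"
    using X(3) by simp
  also have "\<dots> = (A ** X) ** (A ** Y)"
    by (metis matrix_transpose_mul X(3) Y(3))
  also have "\<dots> = A ** Y"
    using X(1) by (metis matrix_mul_assoc)
  finally have AX: "A ** X = A ** Y" .
  have "X ** A = (X ** A) ** (Y ** A)"
    using Y(1) by (metis matrix_mul_assoc)
  then have "X ** A = transpose ((X ** A) ** (Y ** A))"
    using X(4) by simp
  also have "\<dots> = (Y ** A) ** (X ** A)"
    by (metis matrix_transpose_mul X(4) Y(4))
  also have "\<dots> = Y ** A"
    using X(1) by (metis matrix_mul_assoc)
  finally have XA: "X ** A = Y ** A" .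
  have "X = X ** A ** X" using X(2) by simp
  also have "\<dots> = Y ** (A ** X)" by (simp add: XA matrix_mul_assoc)
  also have "\<dots> = Y" by (simp add: AX matrix_mul_assoc Y(2))
  finally show ?thesis .
qed

lemma penrose_pinv:
  assumes "penrose A X"
  shows "pinv A = X"
  using assms penrose_unique[of A] unfolding pinv_def penrose_def[symmetric]
  by (blast intro: the_equality)

text \<open>The pseudoinverse of a symmetric \<open>A\<close> is \<open>(A + P)\<inverse> - P\<close>, where \<open>P\<close> is the orthogonal
  projection onto the kernel.\<close>
lemma symmetric_pinv:
  fixes A :: "real^'n^'n"
  assumes sym: "transpose A = A"
  shows "transpose (pinv A) = pinv A" and "pinv A ** A ** pinv A = pinv A"
proof -
  obtain P :: "real^'n^'n" where P: "transpose P = P" "P ** P = P" "A ** P = 0"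
      "\<And>v. A *v v = 0 \<Longrightarrow> P *v v = v"
    by (rule kernel_projection[of A]) blast
  have PA: "P ** A = 0"
  proof -
    have "P ** A = transpose (A ** P)"
      by (simp add: matrix_transpose_mul sym P(1))
    then show ?thesis
      by (simp add: P(3) transpose_def vec_eq_iff)
  qed
  \<comment> \<open>Multiplying by \<open>P\<close> removes the \<open>A\<close> part and leaves
    \<open>P *v v = 0\<close>; hence \<open>A *v v = 0\<close>, and \<open>P\<close> fixes
    \<open>v\<close>. So \<open>A + P\<close> is invertible.\<close>
  have "v = 0" if "(A + P) *v v = 0" for v
  proof -
    have "P *v ((A + P) *v v) = P *v v"
      by (simp add: matrix_vector_mul_assoc matrix_add_ldistrib PA P(2))
    then have "P *v v = 0"
      using that by simp
    moreover have "A *v v + P *v v = 0"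
      using that by (simp add: matrix_vector_mult_add_rdistrib)
    ultimately show ?thesis
      using P(4) by simp
  qed
  then obtain G where G: "G ** (A + P) = mat 1"
    using matrix_left_invertible_ker[of "A + P"] by auto
  then have G': "(A + P) ** G = mat 1"
    using matrix_left_right_inverse by blast
  have tG: "transpose G = G"
  proof -
    have "transpose G ** (A + P) = mat 1"
      using arg_cong[OF G', of transpose] by (simp add: matrix_transpose_mul transpose_add sym P(1))
    then show ?thesis
      using G' by (metis matrix_mul_assoc matrix_mul_lid matrix_mul_rid)
  qed
  have GP: "G ** P = P"
  proof -
    have "(A + P) ** P = P"
      by (simp add: matrix_add_rdistrib P)
    then show ?thesis
      using G by (metis matrix_mul_assoc matrix_mul_lid)
  qed
  have PG: "P ** G = P"
    using arg_cong[OF GP, of transpose] by (simp add: matrix_transpose_mul tG P(1))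
  have 1: "A ** (G - P) = mat 1 - P"
    using G' PG P(3) by (simp add: matrix_diff_ldistrib matrix_add_rdistrib eq_diff_eq)
  have 2: "(G - P) ** A = mat 1 - P"
    using G GP PA by (simp add: matrix_diff_rdistrib matrix_add_ldistrib eq_diff_eq)
  have 3: "P ** (G - P) = 0"
    by (simp add: matrix_diff_ldistrib PG P(2))
  have "penrose A (G - P)"
    unfolding penrose_def 1 2
    by (simp add: matrix_diff_rdistrib[of "mat 1"] PA 3 transpose_diff P(1))
  then show "transpose (pinv A) = pinv A" "pinv A ** A ** pinv A = pinv A"
    by (auto simp: penrose_pinv transpose_diff tG P(1)) (simp add: penrose_def)
qed

text \<open>Completing the square: with \<open>Y = B ** pinv L\<close>, the two cross terms and the
  quadratic term \<open>Y ** L ** transpose Y\<close> are all equal to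
  \<open>B ** pinv L ** transpose B\<close>, so one negative copy survives.\<close>

lemma sum_outer_diff_pinv:
  fixes a :: "'i \<Rightarrow> real^'p" and e :: "'i \<Rightarrow> real^'q" and I :: "'i set"
  defines "L \<equiv> \<Sum>i\<in>I. outer (e i) (e i)" and "B \<equiv> \<Sum>i\<in>I. outer (a i) (e i)"
  defines "g \<equiv> \<lambda>i. a i - (B ** pinv L) *v e i"
  shows "(\<Sum>i\<in>I. outer (a i) (a i)) - B ** pinv L ** transpose B = (\<Sum>i\<in>I. outer (g i) (g i))"
proof -
  define Y where "Y = B ** pinv L"
  have "transpose L = L"
    by (simp add: L_def transpose_sum transpose_outer)
  note X = symmetric_pinv[OF this]
  have tB: "transpose B = (\<Sum>i\<in>I. outer (e i) (a i))"
    by (simp add: B_def transpose_sum transpose_outer)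
  have tY: "transpose Y = pinv L ** transpose B"
    by (simp add: Y_def matrix_transpose_mul X)
  have "(\<Sum>i\<in>I. outer (g i) (g i)) = (\<Sum>i\<in>I. outer (a i) (a i)) - Y ** (\<Sum>i\<in>I. outer (e i) (a i))
      - (\<Sum>i\<in>I. outer (a i) (e i)) ** transpose Y + Y ** (\<Sum>i\<in>I. outer (e i) (e i)) ** transpose Y"
    by (simp add: g_def Y_def[symmetric] outer_diff matrix_mult_sum_left matrix_mult_sum_right
        matrix_mult_outer outer_matrix_mult sum_subtractf)
  also have "\<dots> = (\<Sum>i\<in>I. outer (a i) (a i)) - Y ** transpose B - B ** transpose Y + Y ** L ** transpose Y"
    by (simp add: tB B_def[symmetric] L_def[symmetric])
  also have "Y ** L ** transpose Y = B ** (pinv L ** L ** pinv L) ** transpose B"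
    unfolding tY by (simp add: Y_def matrix_mul_assoc)
  also have "\<dots> = B ** transpose Y"
    by (simp add: X(2) tY matrix_mul_assoc)
  finally show ?thesis
    by (simp add: Y_def)
qed

lemma trace_sum_outer:
  fixes S :: "real^'d^'p"
  shows "trace ((\<Sum>i\<in>I. outer (g i) (g i)) ** S ** transpose S) = (\<Sum>i\<in>I. (norm (g i v* S))\<^sup>2)"
proof -
  have "trace (outer (g i) (g i) ** S ** transpose S) = (norm (g i v* S))\<^sup>2" for i
  proof -
    have "outer (g i) (g i) ** S = outer (g i) (g i v* S)"
      using outer_matrix_mult[of "g i" "g i" "transpose S"] by simp
    then show ?thesis
      by (simp add: outer_matrix_mult trace_outer dot_lmul_matrix[symmetric] dot_square_norm)
  qed
  then show ?thesis
    by (simp add: matrix_mult_sum_left trace_sum)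
qed

subsection \<open>The objective as a sum of squares\<close>

text \<open>Applied to a stack \<open>S\<close>, this gives the misfit of the edge
  \<open>(k, i)\<close> once the point positions and translations are fitted to \<open>S\<close> by
  least squares.\<close>

definition residual_vec ::
  "('n::finite \<times> 'm::finite) set \<Rightarrow> ('n \<Rightarrow> 'm \<Rightarrow> real^'d) \<Rightarrow> 'n \<Rightarrow> 'm \<Rightarrow> real^('m \<times> 'd)" where
  "residual_vec E x k i = vec_kron (axis i 1) (mat 1) *v x k i
     - (patch_B E x ** pinv (patch_L E)) *v edge_vec k i"

lemma patch_C_eq_sum_outer:
  "patch_C E x = (\<Sum>(k, i)\<in>E. outer (residual_vec E x k i) (residual_vec E x k i))"
  unfolding patch_C_def patch_D_def patch_B_def patch_L_def residual_vec_def
  using sum_outer_diff_pinv[where I = E and a = "\<lambda>p. vec_kron (axis (snd p) 1) (mat 1) *v x (fst p) (snd p)"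
      and e = "\<lambda>p. edge_vec (fst p) (snd p)"]
  by (simp add: split_beta matrix_mult_outer outer_matrix_mult)

lemma align_F_eq:
  "align_F E x S = (\<Sum>(k, i)\<in>E. (norm (residual_vec E x k i v* S))\<^sup>2)"
  unfolding align_F_def patch_C_eq_sum_outer
  using trace_sum_outer[of "\<lambda>p. residual_vec E x (fst p) (snd p)" E S]
  by (simp add: split_beta)

lemma vec_kron_axis_mult:
  "vec_kron (axis i 1) (mat 1) *v (u :: real^'d) = (\<chi> p. if fst p = i then u $ snd p else 0)"
proof -
  have "(\<Sum>b\<in>UNIV. axis i 1 $ l * mat 1 $ a $ b * u $ b) = (if l = i then u $ a else 0)" for l a
    using matrix_vector_mul_lid[of u]
    by (simp add: vec_eq_iff matrix_vector_mult_def axis_def)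
  then show ?thesis
    by (simp add: vec_eq_iff vec_kron_def matrix_vector_mult_def)
qed

text \<open>The columns of \<open>transpose S ** patch_B E x ** pinv (patch_L E)\<close> are the
  fitted point positions (\<open>Inl\<close>) and view translations (\<open>Inr\<close>).
  \<open>S\<close> is an arbitrary stack, so this also reads off velocities from a tangent
  vector.\<close>

lemma residual_vec_mult:
  "residual_vec E x k i v* S = x k i v* block S i
     - (column (Inl k) (transpose S ** patch_B E x ** pinv (patch_L E))
        - column (Inr i) (transpose S ** patch_B E x ** pinv (patch_L E)))"
proof -
  have "(vec_kron (axis i 1) (mat 1) *v x k i) v* S = x k i v* block S i"
  proof -
    have "(\<Sum>p\<in>UNIV. (if fst p = i then x k i $ snd p else 0) * S $ p $ j) =
        (\<Sum>a\<in>UNIV. x k i $ a * S $ (i, a) $ j)" for j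
    proof -
      have "(\<Sum>p\<in>UNIV. (if fst p = i then x k i $ snd p else 0) * S $ p $ j) =
          (\<Sum>l\<in>UNIV. \<Sum>a\<in>UNIV. (if l = i then x k i $ a else 0) * S $ (l, a) $ j)"
        by (simp add: sum.cartesian_product split_beta)
      also have "\<dots> = (\<Sum>l\<in>UNIV. if l = i then \<Sum>a\<in>UNIV. x k i $ a * S $ (i, a) $ j else 0)"
        by (intro sum.cong) auto
      finally show ?thesis by simp
    qed
    then show ?thesis
      by (simp add: vec_eq_iff vec_kron_axis_mult vector_matrix_mult_def block_def)
  qed
  moreover have "((patch_B E x ** pinv (patch_L E)) *v edge_vec k i) v* S =
      (transpose S ** patch_B E x ** pinv (patch_L E)) *v edge_vec k i"
    using transpose_matrix_vector[of S "(patch_B E x ** pinv (patch_L E)) *v edge_vec k i"]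
    by (simp add: matrix_vector_mul_assoc matrix_mul_assoc del: transpose_matrix_vector)
  ultimately show ?thesis
    by (simp add: residual_vec_def vector_matrix_mult_diff_distrib edge_vec_def
        matrix_vector_mult_diff_distrib matrix_vector_mult_basis vector_matrix_left_distrib
        del: transpose_matrix_vector)
qed

subsection \<open>The Hessian\<close>

text \<open>In the second derivative along a curve, the acceleration is paired only with the
  residuals \<open>a i + l i p\<close>, which vanish; what remains depends on the velocity
  alone.\<close>

lemma sum_norm_squares_is_hessian_at:
  fixes a :: "'i \<Rightarrow> 'b::real_inner" and l :: "'i \<Rightarrow> 'a::real_normed_vector \<Rightarrow> 'b"
  assumes lin: "\<And>i. i \<in> I \<Longrightarrow> bounded_linear (l i)"
    and zero: "\<And>i. i \<in> I \<Longrightarrow> a i + l i p = 0"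
  shows "is_hessian_at M (\<lambda>z. \<Sum>i\<in>I. (norm (a i + l i z))\<^sup>2) p (\<lambda>v w. 2 * (\<Sum>i\<in>I. l i v \<bullet> l i w))"
proof -
  have "bilinear (\<lambda>v w. 2 * (\<Sum>i\<in>I. l i v \<bullet> l i w))"
  proof -
    have "l i (u + w) = l i u + l i w" "l i (r *\<^sub>R u) = r *\<^sub>R l i u" if "i \<in> I" for i u w r
      using lin[OF that] by (simp_all add: bounded_linear.linear linear_add linear_scale)
    then show ?thesis
      unfolding bilinear_def linear_iff
      by (simp add: inner_simps sum.distrib distrib_left sum_distrib_left ac_simps)
  qed
  moreover have "\<exists>g. (\<forall>\<^sub>F t in nhds 0. ((\<lambda>s. \<Sum>i\<in>I. (norm (a i + l i (c s)))\<^sup>2) has_real_derivative g t) (at t)) \<and>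
      (g has_real_derivative 2 * (\<Sum>i\<in>I. l i v \<bullet> l i v)) (at 0)"
    if curve: "C2_curve_in M p v c" for v c
  proof -
    define Q where "Q e c' c'' \<longleftrightarrow> c' 0 = v \<and> continuous_on {-e<..<e} c'' \<and>
        (\<forall>t\<in>{-e<..<e}. c t \<in> M \<and> (c has_vector_derivative c' t) (at t) \<and>
                        (c' has_vector_derivative c'' t) (at t))" for e c' c''
    have "c 0 = p" "\<exists>e>0. \<exists>c' c''. Q e c' c''"
      using curve by (simp_all add: C2_curve_in_def Q_def)
    then obtain e c' c'' where "e > 0" "c 0 = p" and Q: "Q e c' c''"
      by blast
    then have e: "e > 0" "c 0 = p" "c' 0 = v"
      by (simp_all add: Q_def)
    have c: "(c has_vector_derivative c' t) (at t)"
      and c': "(c' has_vector_derivative c'' t) (at t)" if "t \<in> {-e<..<e}" for t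
      using Q that by (simp_all add: Q_def)
    \<comment> \<open>The first derivative of the objective along the curve.\<close>
    define g where "g t = 2 * (\<Sum>i\<in>I. (a i + l i (c t)) \<bullet> l i (c' t))" for t
    have lc: "((\<lambda>s. a i + l i (c s)) has_vector_derivative l i (c' t)) (at t)"
      if "t \<in> {-e<..<e}" "i \<in> I" for t i
      using has_vector_derivative_add[OF has_vector_derivative_const
          bounded_linear.has_vector_derivative[OF lin[OF that(2)] c[OF that(1)]]]
      by simp
    have "((\<lambda>s. \<Sum>i\<in>I. (norm (a i + l i (c s)))\<^sup>2) has_real_derivative g t) (at t)"
      if t: "t \<in> {-e<..<e}" for t
    proof -
      have "((\<lambda>s. (a i + l i (c s)) \<bullet> (a i + l i (c s))) has_vector_derivative
          (a i + l i (c t)) \<bullet> l i (c' t) + l i (c' t) \<bullet> (a i + l i (c t))) (at t)" if "i \<in> I" for i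
        by (rule bounded_bilinear.has_vector_derivative[OF bounded_bilinear_inner lc[OF t that] lc[OF t that]])
      then have "((\<lambda>s. \<Sum>i\<in>I. (a i + l i (c s)) \<bullet> (a i + l i (c s))) has_vector_derivative
          (\<Sum>i\<in>I. (a i + l i (c t)) \<bullet> l i (c' t) + l i (c' t) \<bullet> (a i + l i (c t)))) (at t)"
        by (intro has_vector_derivative_sum)
      moreover have "(\<Sum>i\<in>I. (a i + l i (c t)) \<bullet> l i (c' t) + l i (c' t) \<bullet> (a i + l i (c t))) = g t"
        by (simp only: g_def sum_distrib_left mult_2 inner_commute[of "l _ (c' t)"])
      ultimately show ?thesis
        by (simp add: has_real_derivative_iff_has_vector_derivative dot_square_norm)
    qed
    moreover have "\<forall>\<^sub>F t in nhds 0. t \<in> {-e<..<e}"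
      using e(1) by (intro eventually_nhds_in_open) auto
    ultimately have "\<forall>\<^sub>F t in nhds 0. ((\<lambda>s. \<Sum>i\<in>I. (norm (a i + l i (c s)))\<^sup>2) has_real_derivative g t) (at t)"
      by (auto elim: eventually_mono)
    moreover have "(g has_real_derivative 2 * (\<Sum>i\<in>I. l i v \<bullet> l i v)) (at 0)"
    proof -
      have 0: "0 \<in> {-e<..<e}"
        using e(1) by simp
      have D: "((\<lambda>s. (a i + l i (c s)) \<bullet> l i (c' s)) has_vector_derivative
          (a i + l i (c 0)) \<bullet> l i (c'' 0) + l i (c' 0) \<bullet> l i (c' 0)) (at 0)" if "i \<in> I" for i
        by (rule bounded_bilinear.has_vector_derivative[OF bounded_bilinear_inner lc[OF 0 that]
              bounded_linear.has_vector_derivative[OF lin[OF that] c'[OF 0]]])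
      have "((\<lambda>s. (a i + l i (c s)) \<bullet> l i (c' s)) has_real_derivative l i v \<bullet> l i v) (at 0)" if "i \<in> I" for i
        using D[OF that] zero[OF that] e by (simp add: has_real_derivative_iff_has_vector_derivative)
      then show ?thesis
        unfolding g_def by (intro DERIV_cmult DERIV_sum)
    qed
    ultimately show ?thesis
      by blast
  qed
  ultimately show ?thesis
    unfolding is_hessian_at_def by (simp add: inner_commute)
qed

text \<open>Both facts come from differentiating, entry by entry, a constraint that is constant
  along curves: the zero first block, and the orthogonality of the other blocks.\<close>

lemma tangent_space_reduced_alignments:
  assumes v: "v \<in> tangent_space reduced_alignments (p :: real^'d^('m::{finite,linorder} \<times> 'd))"
  shows "block v first_view = 0"
    and "i \<noteq> first_view \<Longrightarrow>
      transpose (block v i) ** block p i = - (transpose (block p i) ** block v i)"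
proof -
  obtain c e c' where e: "e > 0" "c 0 = p" "c' 0 = v"
    and cM: "\<And>t. t \<in> {-e<..<e} \<Longrightarrow> c t \<in> reduced_alignments"
    and c: "\<And>t. t \<in> {-e<..<e} \<Longrightarrow> (c has_vector_derivative c' t) (at t)"
    using v unfolding tangent_space_def C2_curve_in_def by blast
  have "(c has_vector_derivative v) (at 0)"
    using c[of 0] e by simp
  then have D: "((\<lambda>t. c t $ q $ b) has_real_derivative v $ q $ b) (at 0)" for q b
    unfolding has_real_derivative_iff_has_vector_derivative
    by (intro bounded_linear.has_vector_derivative[OF bounded_linear_vec_nth])
  have const: "y = 0" if "(f has_real_derivative y) (at 0)" "\<And>t. t \<in> {-e<..<e} \<Longrightarrow> f t = r" for f y r
  proof -
    have "((\<lambda>_. r) has_real_derivative y) (at 0)"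
      using that(1) by (rule has_field_derivative_transform_within_open[of _ _ _ "{-e<..<e}"])
        (use e that(2) in auto)
    then show ?thesis
      using DERIV_unique DERIV_const by blast
  qed
  show "block v first_view = 0"
  proof -
    have "v $ (first_view, a) $ b = 0" for a b
      using cM by (intro const[OF D, where r = 0]) (auto simp: reduced_alignments_def block_def vec_eq_iff)
    then show ?thesis
      by (simp add: block_def vec_eq_iff)
  qed
  show "transpose (block v i) ** block p i = - (transpose (block p i) ** block v i)"
    if i: "i \<noteq> first_view"
  proof -
    have "(\<Sum>r\<in>UNIV. v $ (i, r) $ a * p $ (i, r) $ b + v $ (i, r) $ b * p $ (i, r) $ a) = 0" for a b
    proof (rule const)
      show "((\<lambda>t. \<Sum>r\<in>UNIV. c t $ (i, r) $ a * c t $ (i, r) $ b) has_real_derivative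
          (\<Sum>r\<in>UNIV. v $ (i, r) $ a * p $ (i, r) $ b + v $ (i, r) $ b * p $ (i, r) $ a)) (at 0)"
        using DERIV_mult[OF D D, of "(i, _)" a "(i, _)" b] by (intro DERIV_sum) (simp add: e)
      show "(\<Sum>r\<in>UNIV. c t $ (i, r) $ a * c t $ (i, r) $ b) = mat 1 $ a $ b" if "t \<in> {-e<..<e}" for t
      proof -
        have "transpose (block (c t) i) ** block (c t) i = mat 1"
          using cM[OF that] i by (simp add: reduced_alignments_def orthogonal_matrix)
        then show ?thesis
          by (simp add: vec_eq_iff matrix_matrix_mult_def transpose_def block_def)
      qed
    qed
    then show ?thesis
      by (simp add: vec_eq_iff matrix_matrix_mult_def transpose_def block_def sum.distrib
          eq_neg_iff_add_eq_0 ac_simps)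
  qed
qed

text \<open>The linear part of the affine map \<open>stack_id\<close>. Clearing the first block
  makes the decomposition valid for every stack, not only for those in
  \<open>reduced_alignments\<close>.\<close>

definition drop_first :: "real^'d^('m::{finite,linorder} \<times> 'd) \<Rightarrow> real^'d^('m \<times> 'd)" where
  "drop_first Z = (\<chi> p. if fst p = first_view then 0 else Z $ p)"

lemma stack_id_eq: "stack_id Z = stack_id 0 + drop_first Z"
  by (simp add: stack_id_def drop_first_def vec_eq_iff)

lemma drop_first_eq: "block Z first_view = 0 \<Longrightarrow> drop_first Z = Z"
  by (auto simp: drop_first_def block_def vec_eq_iff)

lemma reduced_F_eq:
  "reduced_F E x Z = (\<Sum>(k, i)\<in>E. (norm (residual_vec E x k i v* stack_id Z))\<^sup>2)"
  using align_F_eq[of E x "stack_id Z"] by (simp add: reduced_F_def align_F_def)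

lemma bounded_linear_vector_matrix_drop_first:
  "bounded_linear (\<lambda>Z. g v* drop_first Z)"
  unfolding linear_conv_bounded_linear[symmetric]
  by (auto simp: linear_iff vec_eq_iff vector_matrix_mult_def drop_first_def sum.distrib[symmetric]
      sum_distrib_left distrib_left intro!: sum.cong)

text \<open>Identifies the normalized representative of the orbit of \<open>S\<close>; being a right
  multiple of \<open>S\<close>, it inherits the vanishing residuals.\<close>

lemma stack_id_reduce:
  assumes "S \<in> alignments"
  shows "stack_id (reduce S) = S ** transpose (block S first_view)"
proof -
  have "block S first_view ** transpose (block S first_view) = mat 1"
    using assms by (simp add: alignments_def orthogonal_matrix_def)
  then have "(stack_id (reduce S)) $ (i, a) = (block S i ** transpose (block S first_view)) $ a" for i a
    by (simp add: stack_id_def reduce_def)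
  then show ?thesis
    by (simp add: vec_eq_iff block_def matrix_matrix_mult_def)
qed

lemma block_reduce:
  "i \<noteq> first_view \<Longrightarrow> block (reduce S) i = block S i ** transpose (block S first_view)"
  by (simp add: block_def reduce_def vec_eq_iff)

lemma reduce_in_reduced_alignments:
  assumes "S \<in> alignments"
  shows "reduce S \<in> reduced_alignments"
proof -
  have "orthogonal_matrix (block (reduce S) i)" if "i \<noteq> first_view" for i
    using assms that
    by (simp add: block_reduce alignments_def orthogonal_matrix_mul)
  moreover have "block (reduce S) first_view = 0"
    by (simp add: block_def reduce_def vec_eq_iff)
  ultimately show ?thesis
    by (simp add: reduced_alignments_def)
qed

lemma perfect_residual_zero:
  assumes "perfect E x S" "(k, i) \<in> E"
  shows "residual_vec E x k i v* S = 0"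
proof -
  have "(\<Sum>(k, i)\<in>E. (norm (residual_vec E x k i v* S))\<^sup>2) = 0"
    using assms(1) by (simp add: perfect_def align_F_eq)
  then show ?thesis
    using assms(2) by (subst (asm) sum_nonneg_eq_0_iff) auto
qed

text \<open>\<open>reduced_F\<close> is a sum of squares of affine functions vanishing at \<open>reduce S\<close>, so its Hessian
  is the Gram form of the linear parts and kills \<open>v\<close> only if they all vanish at \<open>v\<close>.\<close>
lemma perfect_nondegenerateI:
  fixes E :: "('n::finite \<times> 'm::{finite,linorder}) set" and S :: "real^'d^('m \<times> 'd)"
  assumes S: "perfect E x S"
    and rigid: "\<And>v. v \<in> tangent_space reduced_alignments (reduce S) \<Longrightarrow>
      (\<And>k i. (k, i) \<in> E \<Longrightarrow> residual_vec E x k i v* v = 0) \<Longrightarrow> v = 0"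
  shows "nondegenerate E x S"
proof -
  have al: "S \<in> alignments"
    using S by (simp add: perfect_def)
  define l :: "'n \<times> 'm \<Rightarrow> real^'d^('m \<times> 'd) \<Rightarrow> real^'d"
    where "l = (\<lambda>(k, i) Z. residual_vec E x k i v* drop_first Z)"
  define a :: "'n \<times> 'm \<Rightarrow> real^'d"
    where "a = (\<lambda>(k, i). residual_vec E x k i v* stack_id 0)"
  have al_eq: "a (k, i) + l (k, i) Z = residual_vec E x k i v* stack_id Z" for k i Z
    unfolding stack_id_eq[of Z] by (simp add: a_def l_def vector_matrix_mult_add_rdistrib)
  have F: "reduced_F E x = (\<lambda>Z. \<Sum>e\<in>E. (norm (a e + l e Z))\<^sup>2)"
    by (auto simp: reduced_F_eq al_eq intro!: ext sum.cong)
  have zero: "a e + l e (reduce S) = 0" if "e \<in> E" for e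
  proof (cases e)
    case (Pair k i)
    then show ?thesis
      using that perfect_residual_zero[OF S, of k i]
      by (simp add: al_eq stack_id_reduce[OF al] vector_matrix_mul_assoc[symmetric])
  qed
  have lin: "bounded_linear (l e)" for e
    by (cases e) (simp add: l_def bounded_linear_vector_matrix_drop_first)
  have "local_minimizer_on reduced_alignments (reduced_F E x) (reduce S)"
  proof -
    \<comment> \<open>The left side is zero and the right side is a sum of squares, so the minimum
      is global.\<close>
    have "reduced_F E x (reduce S) \<le> reduced_F E x Z" for Z
      by (simp add: F zero sum_nonneg)
    then show ?thesis
      unfolding local_minimizer_on_def using reduce_in_reduced_alignments[OF al] by simp
  qed
  moreover have "hessian_nonsingular_at reduced_alignments (reduced_F E x) (reduce S)"
    unfolding hessian_nonsingular_at_def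
  proof (intro exI conjI ballI impI)
    show "is_hessian_at reduced_alignments (reduced_F E x) (reduce S)
        (\<lambda>v w. 2 * (\<Sum>e\<in>E. l e v \<bullet> l e w))"
      unfolding F by (rule sum_norm_squares_is_hessian_at) (use lin zero in auto)
    fix v
    assume v: "v \<in> tangent_space reduced_alignments (reduce S)"
      and "\<forall>w\<in>tangent_space reduced_alignments (reduce S). 2 * (\<Sum>e\<in>E. l e v \<bullet> l e w) = 0"
    \<comment> \<open>Test the form with \<open>w = v\<close>.\<close>
    then have "(\<Sum>e\<in>E. l e v \<bullet> l e v) = 0"
      by auto
    then have l0: "\<forall>e\<in>E. l e v = 0"
      by (subst (asm) sum_nonneg_eq_0_iff) auto
    show "v = 0"
    proof (rule rigid[OF v])
      fix k i
      assume "(k, i) \<in> E"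
      with l0 have "l (k, i) v = 0"
        by blast
      then show "residual_vec E x k i v* v = 0"
        by (simp add: l_def drop_first_eq[OF tangent_space_reduced_alignments(1)[OF v]])
    qed
  qed
  ultimately show ?thesis
    by (simp add: nondegenerate_def)
qed

section \<open>Skew matrices and the rank condition of the view graph\<close>

text \<open>A skew matrix has range orthogonal to its kernel, so it cannot have rank one.\<close>
lemma skew_matrix_eq_zero:
  fixes A :: "real^'d^'d" and N :: "real^'n^'d"
  assumes skew: "transpose A = - A" and AN: "A ** N = 0" and rank: "rank N \<ge> CARD('d) - 1"
  shows "A = 0"
proof (rule ccontr)
  assume "A \<noteq> 0"
  then obtain u where u: "A *v u \<noteq> 0"
    by (metis matrix_eq matrix_vector_mult_0)
  define w where "w = A *v u"
  have "a v* A = - (A *v a)" for a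
    using transpose_matrix_vector[of A a] unfolding skew
    by (simp add: vec_eq_iff matrix_vector_mult_def sum_negf)
  then have skew_inner: "a \<bullet> (A *v b) = - ((A *v a) \<bullet> b)" for a b
    by (simp add: dot_lmul_matrix[symmetric])
  have ker: "A *v z = 0" if "z \<in> span (columns N)" for z
  proof (rule linear_eq_on_span[where f = "(*v) A" and g = "\<lambda>_. 0"])
    show "A *v b = 0" if "b \<in> columns N" for b
    proof -
      obtain i where "b = N *v axis i 1"
        using \<open>b \<in> columns N\<close> by (auto simp: columns_def matrix_vector_mult_basis)
      then show ?thesis
        by (simp add: matrix_vector_mul_assoc AN)
    qed
  qed (use that in \<open>auto simp: linear_zero\<close>)
  have "span (columns N) \<subseteq> {z. w \<bullet> z = 0}"
  proof
    fix z assume "z \<in> span (columns N)"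
    then show "z \<in> {z. w \<bullet> z = 0}"
      using ker skew_inner[of z u] by (simp add: w_def inner_commute)
  qed
  moreover have "dim {z. w \<bullet> z = 0} \<le> dim (span (columns N))"
    using rank dim_hyperplane[of w] u by (simp add: w_def column_rank_def)
  \<comment> \<open>The column space lies in the hyperplane orthogonal to \<open>w\<close> and has
    at least its dimension. Skewness puts \<open>u\<close> in this hyperplane too, so
    \<open>A\<close> kills \<open>u\<close>, a contradiction.\<close>
  ultimately have "span (columns N) = {z. w \<bullet> z = 0}"
    using subspace_dim_equal[OF subspace_span subspace_hyperplane] by blast
  moreover have "w \<bullet> u = 0"
    using skew_inner[of u u] by (simp add: w_def inner_commute)
  ultimately show False
    using ker[of u] u by simp
qed

text \<open>Each shared column is sent to the same vector \<open>c\<close>, and centring annihilates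
  the all-ones vector. This turns equality of two affine motions on shared points into a linear
  equation for their difference.\<close>

lemma mult_common_B_centred:
  fixes A :: "real^'d^'q"
  assumes A: "\<And>k. k \<in> pts u \<inter> pts v \<Longrightarrow> A *v y k u = c"
  shows "A ** common_B_centred pts y u v = 0"
proof -
  let ?K = "pts u \<inter> pts v"
  have AB: "A ** common_B pts y u v = outer c (ones_on ?K)"
  proof -
    have "(A ** common_B pts y u v) $ a $ k = outer c (ones_on ?K) $ a $ k" for a k
      using A[of k] by (auto simp: vec_eq_iff outer_def ones_on_def common_B_def
          matrix_matrix_mult_def matrix_vector_mult_def)
    then show ?thesis
      by (simp add: vec_eq_iff)
  qed
  have "ones_on ?K \<bullet> ones_on ?K = real (card ?K)"
    by (simp add: inner_vec_def ones_on_def if_distrib sum.If_cases Int_def cong: if_cong)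
  \<comment> \<open>Without common points \<open>1 / 0 = 0\<close> makes the centring matrix the
    identity, but the vector to be annihilated is already zero.\<close>
  moreover have "ones_on ?K = 0" if "card ?K = 0"
    using that by (auto simp: ones_on_def vec_eq_iff)
  ultimately have "ones_on ?K - (1 / real (card ?K)) *\<^sub>R ((ones_on ?K \<bullet> ones_on ?K) *\<^sub>R ones_on ?K) = 0"
    by (cases "card ?K = 0") auto
  moreover have "transpose (mat 1 - (1 / real (card ?K)) *\<^sub>R outer (ones_on ?K) (ones_on ?K))
      = mat 1 - (1 / real (card ?K)) *\<^sub>R outer (ones_on ?K) (ones_on ?K)"
    by (simp add: transpose_diff transpose_scalar transpose_outer)
  then have "outer c (ones_on ?K) ** (mat 1 - (1 / real (card ?K)) *\<^sub>R outer (ones_on ?K) (ones_on ?K))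
      = outer c ((mat 1 - (1 / real (card ?K)) *\<^sub>R outer (ones_on ?K) (ones_on ?K)) *v ones_on ?K)"
    by (metis outer_matrix_mult)
  ultimately show ?thesis
    by (simp add: common_B_centred_def Let_def matrix_mul_assoc AB matrix_vector_mult_diff_rdistrib
        scaleR_matrix_vector_assoc[symmetric] outer_vector_mult outer_zero)
qed

text \<open>Serves to show that for dimension above one, views joined by an edge share a
  point.\<close>

lemma common_B_centred_disjoint: "pts u \<inter> pts v = {} \<Longrightarrow> common_B_centred pts y u v = 0"
  using mult_common_B_centred[of pts u v "mat 1" y 0] by simp

subsection \<open>Coarsening\<close>

text \<open>Indexing classes by their members makes a merging step the image of the family under one
  map.\<close>

lemma merge_views_eq:
  "merge_views E x S P =
    (\<lambda>U. \<Union>(((merged_graph E x S P \<union> (merged_graph E x S P)\<inverse>)\<^sup>* \<inter> P \<times> P) `` {U})) ` P"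
  by (auto simp: merge_views_def graph_components_def quotient_def)

text \<open>Makes the coarsening loop terminate. If the merging map were injective on
  \<open>P\<close>, every class would be a singleton and merging would change nothing.\<close>

lemma card_merge_views:
  assumes neq: "merge_views E x S P \<noteq> P"
  shows "card (merge_views E x S P) < card P"
proof -
  define r where "r = (merged_graph E x S P \<union> (merged_graph E x S P)\<inverse>)\<^sup>* \<inter> P \<times> P"
  define f where "f = (\<lambda>U. \<Union>(r `` {U}))"
  have mv: "merge_views E x S P = f ` P"
    by (simp add: merge_views_eq f_def r_def)
  have "sym r"
    unfolding r_def by (intro sym_Int sym_rtrancl sym_Un_converse) (auto simp: sym_def)
  moreover have "trans r"
    unfolding r_def by (intro trans_Int trans_rtrancl) (auto simp: trans_def)
  ultimately have f_eq: "f U = f V" if "(U, V) \<in> r" for U V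
  proof -
    have "r `` {U} = r `` {V}"
      using that \<open>sym r\<close> \<open>trans r\<close> by (auto simp: Image_def) (meson symD transD)+
    then show ?thesis
      by (simp add: f_def)
  qed
  have "\<not> inj_on f P"
  proof
    assume inj: "inj_on f P"
    have "f U = U" if "U \<in> P" for U
    proof -
      have "V = U" if "(U, V) \<in> r" for V
        using inj_onD[OF inj f_eq[OF that]] that by (simp add: r_def)
      moreover have "(U, U) \<in> r"
        using that by (simp add: r_def)
      ultimately have "r `` {U} = {U}"
        by blast
      then show ?thesis
        by (simp add: f_def)
    qed
    then show False
      using neq mv by simp
  qed
  then show ?thesis
    unfolding mv by (meson card_image_le eq_card_imp_inj_on finite le_neq_implies_less)
qed

text \<open>Induction principle for coarsening: a label of the original views that propagates across
  every edge stays constant on each merged view, hence is constant when one view is left.\<close>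

lemma final_views_singleton_const:
  fixes E :: "('n::finite \<times> 'm::finite) set" and \<phi> :: "'m \<Rightarrow> 'a"
  assumes one: "card (final_views E x S) = 1"
    and edge: "\<And>P U V i j. (U, V) \<in> merged_graph E x S P \<Longrightarrow>
      (\<And>i' j'. i' \<in> U \<Longrightarrow> j' \<in> U \<Longrightarrow> \<phi> i' = \<phi> j') \<Longrightarrow>
      (\<And>i' j'. i' \<in> V \<Longrightarrow> j' \<in> V \<Longrightarrow> \<phi> i' = \<phi> j') \<Longrightarrow> i \<in> U \<Longrightarrow> j \<in> V \<Longrightarrow> \<phi> i = \<phi> j"
  shows "\<phi> i = \<phi> j"
proof -
  \<comment> \<open>Nonemptiness lets labels be compared along a path of views; covering ensures
    that a single remaining view contains all the original ones.\<close>
  define Inv where "Inv = (\<lambda>P. {} \<notin> P \<and> \<Union>P = UNIV \<and> (\<forall>U\<in>P. \<forall>i\<in>U. \<forall>j\<in>U. \<phi> i = \<phi> j))"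
  have step: "Inv (merge_views E x S P)" if P: "Inv P" for P
  proof -
    have ne: "{} \<notin> P" and cover: "\<Union>P = UNIV"
      and P\<phi>: "\<forall>U\<in>P. \<forall>i\<in>U. \<forall>j\<in>U. \<phi> i = \<phi> j"
      using P unfolding Inv_def by - (elim conjE, assumption)+
    define R where "R = merged_graph E x S P \<union> (merged_graph E x S P)\<inverse>"
    define f where "f = (\<lambda>U. \<Union>((R\<^sup>* \<inter> P \<times> P) `` {U}))"
    have mv: "merge_views E x S P = f ` P"
      by (simp add: merge_views_eq f_def R_def)
    have subset: "U \<subseteq> f U" if "U \<in> P" for U
      using that by (auto simp: f_def)
    have RP: "R \<subseteq> P \<times> P"
      by (auto simp: R_def merged_graph_def view_graph_def)
    have R: "\<phi> i = \<phi> j" if "(U, V) \<in> R" "i \<in> U" "j \<in> V" for U V i j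
    proof -
      have U: "\<phi> i' = \<phi> j'" if "i' \<in> U" "j' \<in> U" for i' j'
        using that \<open>(U, V) \<in> R\<close> RP P\<phi> by blast
      have V: "\<phi> i' = \<phi> j'" if "i' \<in> V" "j' \<in> V" for i' j'
        using that \<open>(U, V) \<in> R\<close> RP P\<phi> by blast
      from that(1) consider "(U, V) \<in> merged_graph E x S P" | "(V, U) \<in> merged_graph E x S P"
        by (auto simp: R_def)
      then show ?thesis
        using edge[OF _ U V that(2,3)] edge[OF _ V U that(3,2)] by cases metis+
    qed
    have "V \<in> P \<and> (\<forall>i\<in>U. \<forall>j\<in>V. \<phi> i = \<phi> j)" if "(U, V) \<in> R\<^sup>*" "U \<in> P" for U V
      using that(1)
    proof (induction rule: rtrancl_induct)
      case base
      then show ?case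
        using P\<phi> that(2) by blast
    next
      case (step V W)
      \<comment> \<open>An element of the intermediate view \<open>V\<close> links the labels of
        \<open>U\<close> to those of \<open>W\<close>.\<close>
      then have "V \<noteq> {}" "W \<in> P"
        using ne RP step.IH step.hyps(2) by blast+
      then show ?case
        using step.IH R[OF step.hyps(2)] by (metis all_not_in_conv)
    qed
    note chain = this
    have const: "\<phi> i = \<phi> j" if "U \<in> P" "i \<in> U" "j \<in> f U" for U i j
    proof -
      obtain V where V: "(U, V) \<in> R\<^sup>*" "j \<in> V"
        using \<open>j \<in> f U\<close> unfolding f_def by blast
      then show ?thesis
        using chain[OF V(1) that(1)] that(2) by simp
    qed
    have "\<phi> i = \<phi> j" if "U \<in> P" "i \<in> f U" "j \<in> f U" for U i j
    proof -
      obtain i0 where i0: "i0 \<in> U"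
        using \<open>U \<in> P\<close> ne by (metis ex_in_conv)
      then show ?thesis
        using const[OF that(1) i0 that(2)] const[OF that(1) i0 that(3)] by simp
    qed
    moreover have "\<Union>(f ` P) = UNIV"
      using cover subset by blast
    moreover have "{} \<notin> f ` P"
      using ne subset by (metis imageE subset_empty)
    ultimately show ?thesis
      unfolding mv Inv_def by blast
  qed
  have "card (final_views E x S) = 1 \<longrightarrow> (\<forall>i j. \<phi> i = \<phi> j)"
    unfolding final_views_def
  proof (rule while_rule[where P = Inv and r = "Wellfounded.measure card"])
    show "Inv (range (\<lambda>i. {i}))"
      by (auto simp: Inv_def)
    show "card P = 1 \<longrightarrow> (\<forall>i j. \<phi> i = \<phi> j)" if "Inv P" for P
    proof
      assume "card P = 1"
      then obtain U where U: "P = {U}"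
        by (rule card_1_singletonE)
      with that have "U = UNIV"
        by (simp add: Inv_def)
      then show "\<forall>i j. \<phi> i = \<phi> j"
        using that U unfolding Inv_def by blast
    qed
  qed (simp_all add: step card_merge_views)
  then show ?thesis
    using one by blast
qed

subsection \<open>Rigidity\<close>

text \<open>Passing from \<open>Y\<close> to \<open>patch_H E x S\<close> subtracts one vector from
  all columns, so differences of columns, and with them the equation of zero residual, are
  unchanged.\<close>

lemma perfect_aligned_coord:
  assumes "perfect E x S" "(k, i) \<in> E"
  shows "aligned_coord E x S k i = column (Inl k) (patch_H E x S)"
proof -
  define Y where "Y = transpose S ** patch_B E x ** pinv (patch_L E)"
  have "patch_H E x S = Y - outer ((1 / real CARD('a)) *\<^sub>R (Y *v ones_on (range Inl))) (ones_on UNIV)"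
    unfolding patch_H_def Y_def[symmetric]
    by (simp add: matrix_diff_ldistrib matrix_scalar_ac matrix_mult_outer)
       (simp add: outer_def vec_eq_iff matrix_vector_mult_scaleR scaleR_matrix_vector_assoc[symmetric])
  then have "column (Inl k) (patch_H E x S) - column (Inr i) (patch_H E x S)
      = column (Inl k) Y - column (Inr i) Y"
    by (simp add: column_def outer_def ones_on_def vec_eq_iff)
  moreover have "x k i v* block S i = column (Inl k) Y - column (Inr i) Y"
    using perfect_residual_zero[OF assms] by (simp add: residual_vec_mult Y_def)
  ultimately have "x k i v* block S i = column (Inl k) (patch_H E x S) - column (Inr i) (patch_H E x S)"
    by simp
  then show ?thesis
    by (simp add: aligned_coord_def)
qed

text \<open>Membership of \<open>k\<close> in some view of \<open>U\<close> makes the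
  \<open>THE\<close> well defined. The value does not depend on \<open>U\<close>, so merged views
  can be compared directly.\<close>

lemma perfect_merged_coord:
  assumes "perfect E x S" "k \<in> merged_points E U"
  shows "merged_coord E x S k U = column (Inl k) (patch_H E x S)"
  unfolding merged_coord_def
proof (rule the_equality)
  obtain i where i: "i \<in> U" "(k, i) \<in> E"
    using assms(2) by (auto simp: merged_points_def view_points_def)
  show "c = column (Inl k) (patch_H E x S)"
    if "\<forall>i\<in>U. k \<in> view_points E i \<longrightarrow> aligned_coord E x S k i = c" for c
    using that i perfect_aligned_coord[OF assms(1) i(2)] by (auto simp: view_points_def)
qed (use perfect_aligned_coord[OF assms(1)] in \<open>auto simp: view_points_def\<close>)

text \<open>An infinitesimal motion of the aligned points that is a rigid motion on each view is the same
  rigid motion on all views of a component; for \<open>d = 1\<close> a view graph may join views without a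
  common point, but then there are no infinitesimal rotations.\<close>
lemma infinitesimal_rotations_agree:
  fixes E :: "('n::finite \<times> 'm::finite) set" and S :: "real^'d^('m \<times> 'd)"
    and A :: "'m \<Rightarrow> real^'d^'d"
  assumes S: "perfect E x S" and one: "card (final_views E x S) = 1"
    and skew: "\<And>i. transpose (A i) = - A i"
    and motion: "\<And>k i. (k, i) \<in> E \<Longrightarrow> A i *v column (Inl k) (patch_H E x S) + \<tau> i = y k"
  shows "A i = A j"
proof (cases "CARD('d) = 1")
  case True
  have "A i = 0" for i
  proof (rule skew_matrix_eq_zero[OF skew, where N = "0 :: real^'d^'d"])
    show "A i ** (0 :: real^'d^'d) = 0"
      by (simp add: vec_eq_iff matrix_matrix_mult_def)
  qed (simp add: True)
  then show ?thesis
    by simp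
next
  case False
  \<comment> \<open>The label includes the translation: only a common full motion on a merged view
    lets the argument be repeated for edges between merged views.\<close>
  have "(A i, \<tau> i) = (A j, \<tau> j)"
  proof (rule final_views_singleton_const[OF one, where \<phi> = "\<lambda>i. (A i, \<tau> i)"])
    fix P U V i j
    assume UV: "(U, V) \<in> merged_graph E x S P" and ij: "i \<in> U" "j \<in> V"
      and U: "\<And>i j. i \<in> U \<Longrightarrow> j \<in> U \<Longrightarrow> (A i, \<tau> i) = (A j, \<tau> j)"
      and V: "\<And>i j. i \<in> V \<Longrightarrow> j \<in> V \<Longrightarrow> (A i, \<tau> i) = (A j, \<tau> j)"
    let ?q = "\<lambda>k. column (Inl k) (patch_H E x S)"
    let ?K = "merged_points E U \<inter> merged_points E V"
    let ?N = "common_B_centred (merged_points E) (merged_coord E x S) U V"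
    have rank: "rank ?N \<ge> CARD('d) - 1"
      using UV by (simp add: merged_graph_def view_graph_def)
    have move: "A i *v ?q k + \<tau> i = y k" "A j *v ?q k + \<tau> j = y k" if k: "k \<in> ?K" for k
    proof -
      obtain i' j' where "i' \<in> U" "(k, i') \<in> E" "j' \<in> V" "(k, j') \<in> E"
        using k by (auto simp: merged_points_def view_points_def)
      then show "A i *v ?q k + \<tau> i = y k" "A j *v ?q k + \<tau> j = y k"
        using U[OF ij(1)] V[OF ij(2)] motion by (metis prod.inject)+
    qed
    have "(A i - A j) ** ?N = 0"
    proof (rule mult_common_B_centred)
      show "(A i - A j) *v merged_coord E x S k U = \<tau> j - \<tau> i" if "k \<in> ?K" for k
        using move[OF that] that
        by (simp add: perfect_merged_coord[OF S] matrix_vector_mult_diff_rdistrib algebra_simps)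
    qed
    moreover have "transpose (A i - A j) = - (A i - A j)"
      by (simp add: transpose_diff skew)
    ultimately have "A i - A j = 0"
      using rank by (intro skew_matrix_eq_zero)
    \<comment> \<open>With equal rotations, any one shared point forces equal translations.\<close>
    moreover have "?K \<noteq> {}"
    proof
      assume "?K = {}"
      then have "CARD('d) \<le> 1"
        using rank by (simp add: common_B_centred_disjoint)
      then show False
        using False zero_less_card_finite[where 'a = 'd] by linarith
    qed
    ultimately show "(A i, \<tau> i) = (A j, \<tau> j)"
      using move by (metis add_left_cancel all_not_in_conv eq_iff_diff_eq_0)
  qed
  then show ?thesis
    by simp
qed

theorem theorem4p6:
  fixes E :: "('n::finite \<times> 'm::{finite,linorder}) set"
    and x :: "'n \<Rightarrow> 'm \<Rightarrow> real^'d"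
    and S :: "real^'d^('m \<times> 'd)"
  assumes "patch_connected E"
    and "\<And>i. affinely_nondegenerate E x i"
    and "perfect E x S"
    and "card (final_views E x S) = 1"
  shows "nondegenerate E x S"
proof (rule perfect_nondegenerateI[OF assms(3)])
  fix v
  assume v: "v \<in> tangent_space reduced_alignments (reduce S)"
    and res: "\<And>k i. (k, i) \<in> E \<Longrightarrow> residual_vec E x k i v* v = 0"
  define H where "H = patch_H E x S"
  \<comment> \<open>Point and view velocities fitted to \<open>v\<close>, up to the rotation
    \<open>transpose S\<^sub>1\<close>.\<close>
  define Y where "Y = transpose v ** patch_B E x ** pinv (patch_L E)"
  define S\<^sub>1 where "S\<^sub>1 = block S first_view"
  \<comment> \<open>Since \<open>S\<close> is the normalized stack times \<open>S\<^sub>1\<close>,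
    the direction \<open>v\<close> moves \<open>transpose (block S i)\<close> by
    \<open>transpose S\<^sub>1 ** transpose (block v i)\<close>. Rewriting this in aligned
    coordinates contributes the factor \<open>block S i\<close>.\<close>
  define A where "A i = transpose S\<^sub>1 ** transpose (block v i) ** block S i" for i
  have orth: "transpose (block S i) ** block S i = mat 1" "block S i ** transpose (block S i) = mat 1" for i
    using assms(3) by (auto simp: perfect_def alignments_def orthogonal_matrix_def)
  have v1: "block v first_view = 0"
    using tangent_space_reduced_alignments(1)[OF v] .
  have skew: "transpose (A i) = - A i" for i
  proof (cases "i = first_view")
    case True
    then show ?thesis
      by (simp add: A_def v1 vec_eq_iff matrix_matrix_mult_def transpose_def)
  next
    case False
    let ?W = "transpose (block v i)"
    \<comment> \<open>The tangent condition at \<open>block S i ** transpose S\<^sub>1\<close>;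
      conjugating it by \<open>S\<^sub>1\<close> gives the skewness of \<open>A i\<close>.\<close>
    have "?W ** (block S i ** transpose S\<^sub>1) = - (S\<^sub>1 ** transpose (block S i) ** block v i)"
      using tangent_space_reduced_alignments(2)[OF v False] False
      by (simp add: block_reduce S\<^sub>1_def matrix_transpose_mul)
    then have "transpose S\<^sub>1 ** (?W ** (block S i ** transpose S\<^sub>1)) ** S\<^sub>1 =
        transpose S\<^sub>1 ** (- (S\<^sub>1 ** transpose (block S i) ** block v i)) ** S\<^sub>1"
      by simp
    moreover have "transpose S\<^sub>1 ** (?W ** (block S i ** transpose S\<^sub>1)) ** S\<^sub>1 =
        A i ** (transpose S\<^sub>1 ** S\<^sub>1)"
      by (simp add: A_def matrix_mul_assoc)
    moreover have "transpose S\<^sub>1 ** (- (S\<^sub>1 ** transpose (block S i) ** block v i)) ** S\<^sub>1 =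
        - ((transpose S\<^sub>1 ** S\<^sub>1) ** transpose (block S i) ** block v i ** S\<^sub>1)"
      by (simp add: matrix_mult_minus matrix_mul_assoc)
    ultimately have "A i = - (transpose (block S i) ** block v i ** S\<^sub>1)"
      by (simp add: S\<^sub>1_def orth)
    moreover have "transpose (A i) = transpose (block S i) ** block v i ** S\<^sub>1"
      by (simp add: A_def matrix_transpose_mul matrix_mul_assoc)
    ultimately show ?thesis
      by simp
  qed
  \<comment> \<open>Zero residuals of \<open>v\<close> say that the aligned points move with
    velocities \<open>transpose S\<^sub>1 *v column (Inl k) Y\<close>, rigidly on each view.\<close>
  have "A i = A first_view" for i
  proof (rule infinitesimal_rotations_agree[OF assms(3,4) skew])
    fix k i
    assume ki: "(k, i) \<in> E"
    have q: "column (Inl k) H = transpose (block S i) *v x k i + column (Inr i) H"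
      using perfect_aligned_coord[OF assms(3) ki]
      by (simp add: aligned_coord_def H_def del: transpose_matrix_vector)
    have "transpose (block v i) *v x k i = column (Inl k) Y - column (Inr i) Y"
      using res[OF ki] by (simp add: residual_vec_mult Y_def)
    moreover have "A i *v (transpose (block S i) *v x k i) =
        transpose S\<^sub>1 *v (transpose (block v i) *v x k i)"
    proof -
      have "A i ** transpose (block S i) = transpose S\<^sub>1 ** transpose (block v i)"
        by (metis A_def orth(2) matrix_mul_assoc matrix_mul_rid)
      then show ?thesis
        by (simp add: matrix_vector_mul_assoc del: transpose_matrix_vector)
    qed
    ultimately show "A i *v column (Inl k) (patch_H E x S) +
        (transpose S\<^sub>1 *v column (Inr i) Y - A i *v column (Inr i) H) = transpose S\<^sub>1 *v column (Inl k) Y"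
      unfolding H_def[symmetric] q
      by (simp add: matrix_vector_right_distrib matrix_vector_mult_diff_distrib
          del: transpose_matrix_vector)
  qed
  \<comment> \<open>The first block is fixed, which excludes a global rotation.\<close>
  moreover have "A first_view = 0"
    by (simp add: A_def v1 vec_eq_iff matrix_matrix_mult_def transpose_def)
  ultimately have A0: "A i = 0" for i
    by simp
  have "transpose (block v i) = 0" for i
  proof -
    have "transpose (block v i) = (S\<^sub>1 ** transpose S\<^sub>1) ** transpose (block v i) ** (block S i ** transpose (block S i))"
      by (simp add: S\<^sub>1_def orth)
    also have "\<dots> = S\<^sub>1 ** A i ** transpose (block S i)"
      by (simp add: A_def matrix_mul_assoc)
    also have "\<dots> = 0"
      by (simp add: A0 vec_eq_iff matrix_matrix_mult_def)
    finally show ?thesis .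
  qed
  then show "v = 0"
    by (simp add: vec_eq_iff block_def transpose_def)
qed

end
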